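(* Let $n\ge1$. The subposet of the weak Bruhat poset $\mathbb{S}_n$ made of the covering relations of type (1) is a connected graph; that is, the graph with vertex set $\mathbb{S}_n$ whose (undirected) edges are the covering relations of type (1) is connected.
   Context: $\mathbb{S}_n$ is the symmetric group with Coxeter generators $s_i=(i\ i{+}1)$, $1\le i\le n-1$, and length function $\ell$. The weak Bruhat order on $\mathbb{S}_n$ is the partial order whose covering relations are $\sigma\to\omega$ with $\omega=s_i\sigma$ for some $i$ and $\ell(\omega)=\ell(\sigma)+1$ (left multiplication, which exchanges the values $i$ and $i+1$ in the list $[\sigma(1)\dots\sigma(n)]$; the length condition means $\sigma^{-1}(i)<\sigma^{-1}(i+1)$). Such a covering relation $\sigma\to s_i\sigma$ is of type (1) if $\sigma(j)<i$ for all $j$ with $\sigma^{-1}(i)<j<\sigma^{-1}(i+1)$. *)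

theory Defs
  imports "Graph_Theory.Graph_Theory" "HOL-Combinatorics.Permutations"
begin

text \<open>
  The symmetric group on n letters is the set of functions permuting \<open>{1..n}\<close>, with product \<open>\<circ>\<close>
  (so \<open>\<omega> \<circ> \<sigma>\<close> applies \<open>\<sigma>\<close> first, and multiplying on the left acts on values).
\<close>

definition Sym :: "nat \<Rightarrow> (nat \<Rightarrow> nat) set" where
  "Sym n = {\<sigma>. \<sigma> permutes {1..n}}"

definition coxeter_gen :: "nat \<Rightarrow> nat \<Rightarrow> nat" where
  "coxeter_gen i = Transposition.transpose i (i + 1)"

definition word_prod :: "nat list \<Rightarrow> nat \<Rightarrow> nat" where
  "word_prod ws = foldr (\<lambda>i \<tau>. coxeter_gen i \<circ> \<tau>) ws id"

text \<open>
  The Coxeter length: the least number of factors in a word in the generators representing \<open>\<sigma>\<close>.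
  It is meaningful for \<open>\<sigma> \<in> Sym n\<close> only.
\<close>

definition coxeter_length :: "nat \<Rightarrow> (nat \<Rightarrow> nat) \<Rightarrow> nat" where
  "coxeter_length n \<sigma> =
     (LEAST k. \<exists>ws. set ws \<subseteq> {1..<n} \<and> length ws = k \<and> word_prod ws = \<sigma>)"

definition weak_cover_at :: "nat \<Rightarrow> nat \<Rightarrow> (nat \<Rightarrow> nat) \<Rightarrow> (nat \<Rightarrow> nat) \<Rightarrow> bool" where
  "weak_cover_at n i \<sigma> \<omega> \<longleftrightarrow>
     \<sigma> \<in> Sym n \<and> \<omega> \<in> Sym n \<and> i \<in> {1..<n} \<and> \<omega> = coxeter_gen i \<circ> \<sigma> \<and>
     coxeter_length n \<omega> = coxeter_length n \<sigma> + 1"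

text \<open>The index \<open>i\<close> is determined by \<open>\<sigma>\<close> and \<open>\<omega>\<close>, so the existential only names it.\<close>

definition type1_cover :: "nat \<Rightarrow> (nat \<Rightarrow> nat) \<Rightarrow> (nat \<Rightarrow> nat) \<Rightarrow> bool" where
  "type1_cover n \<sigma> \<omega> \<longleftrightarrow>
     (\<exists>i. weak_cover_at n i \<sigma> \<omega> \<and>
          (\<forall>j. inv \<sigma> i < j \<and> j < inv \<sigma> (i + 1) \<longrightarrow> \<sigma> j < i))"

text \<open>
  Arcs point upwards in the weak order; the predicate \<open>connected\<close> of the graph library
  passes to the underlying undirected graph.
\<close>

definition type1_graph :: "nat \<Rightarrow> (nat \<Rightarrow> nat) pair_pre_digraph" where
  "type1_graph n = \<lparr> pverts = Sym n, parcs = {(\<sigma>, \<omega>). type1_cover n \<sigma> \<omega>} \<rparr>"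

end

theory Submission
  imports Defs
begin

text \<open>
  Two permutations that place the values below \<open>k\<close> in the same positions are connected, by downward
  induction on \<open>k\<close>. Suppose they place \<open>k\<close> at \<open>p < q\<close>, and let \<open>p'\<close> be the next position after \<open>p\<close>
  holding a value above \<open>k\<close>. By induction one may bring the value \<open>k + 1\<close> to \<open>p'\<close>; everything strictly
  between \<open>p\<close> and \<open>p'\<close> is smaller than \<open>k\<close>, so exchanging \<open>k\<close> and \<open>k + 1\<close> is a type (1) covering,
  and \<open>k\<close> has moved one step towards \<open>q\<close>. The length condition on coverings is checked by
  identifying the Coxeter length with the number of inversions.
\<close>

section \<open>Inversions under left multiplication by a generator\<close>

definition inversions :: "nat \<Rightarrow> (nat \<Rightarrow> nat) \<Rightarrow> (nat \<times> nat) set" where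
  "inversions n \<sigma> = {(a, b). a \<in> {1..n} \<and> b \<in> {1..n} \<and> a < b \<and> \<sigma> b < \<sigma> a}"

lemma finite_inversions: "finite (inversions n \<sigma>)"
  by (rule finite_subset[of _ "{1..n} \<times> {1..n}"]) (auto simp: inversions_def)

lemma inversions_id: "inversions n id = {}"
  by (auto simp: inversions_def)

lemma coxeter_gen_permutes: "i \<in> {1..<n} \<Longrightarrow> coxeter_gen i permutes {1..n}"
  unfolding coxeter_gen_def by (rule permutes_swap_id) auto

lemma coxeter_gen_comp_permutes:
  "\<sigma> permutes {1..n} \<Longrightarrow> i \<in> {1..<n} \<Longrightarrow> coxeter_gen i \<circ> \<sigma> permutes {1..n}"
  by (intro permutes_compose coxeter_gen_permutes)

lemma coxeter_gen_comp_cancel: "coxeter_gen i \<circ> (coxeter_gen i \<circ> \<sigma>) = \<sigma>"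
  by (auto simp: coxeter_gen_def fun_eq_iff)

text \<open>No integer lies strictly between \<open>i\<close> and \<open>i + 1\<close>, so
  exchanging them can only reverse the comparison of these two with each other.\<close>

lemma coxeter_gen_less_iff:
  assumes "{x, y} \<noteq> {i, i + 1}"
  shows "coxeter_gen i x < coxeter_gen i y \<longleftrightarrow> x < y"
  using assms by (auto simp: coxeter_gen_def transpose_def)

text \<open>The pair \<open>(p, q)\<close> becomes an inversion; every other pair of positions keeps
  its status by \<open>coxeter_gen_less_iff\<close>.\<close>

lemma inversions_coxeter_gen_comp:
  assumes \<sigma>: "\<sigma> permutes {1..n}" and i: "i \<in> {1..<n}"
    and p: "\<sigma> p = i" and q: "\<sigma> q = i + 1" and pq: "p < q"
  shows "card (inversions n (coxeter_gen i \<circ> \<sigma>)) = card (inversions n \<sigma>) + 1"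
proof -
  have mem: "p \<in> {1..n}" "q \<in> {1..n}"
    using i p q permutes_in_image[OF \<sigma>, of p] permutes_in_image[OF \<sigma>, of q] by auto
  have inj: "inj \<sigma>" using \<sigma> by (rule permutes_inj)
  have iff: "(a, b) \<in> inversions n (coxeter_gen i \<circ> \<sigma>) \<longleftrightarrow> (a, b) = (p, q) \<or> (a, b) \<in> inversions n \<sigma>"
    for a b
  proof (cases "{\<sigma> b, \<sigma> a} = {i, i + 1}")
    case True
    then consider "\<sigma> a = \<sigma> p" "\<sigma> b = \<sigma> q" | "\<sigma> a = \<sigma> q" "\<sigma> b = \<sigma> p"
      unfolding p q by (auto simp: doubleton_eq_iff)
    then show ?thesis
    proof cases
      case 1
      then have "a = p" "b = q" using inj by (auto dest: injD)
      then show ?thesis using mem pq p q by (simp add: inversions_def coxeter_gen_def)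
    next
      case 2
      then have "a = q" "b = p" using inj by (auto dest: injD)
      then show ?thesis using pq by (simp add: inversions_def)
    qed
  next
    case False
    then have "(a, b) \<noteq> (p, q)" using p q by auto
    then show ?thesis using coxeter_gen_less_iff[OF False] by (auto simp: inversions_def)
  qed
  have "inversions n (coxeter_gen i \<circ> \<sigma>) = insert (p, q) (inversions n \<sigma>)"
  proof (rule set_eqI)
    fix x show "x \<in> inversions n (coxeter_gen i \<circ> \<sigma>) \<longleftrightarrow> x \<in> insert (p, q) (inversions n \<sigma>)"
      using iff by (cases x) simp
  qed
  moreover have "(p, q) \<notin> inversions n \<sigma>" using p q by (auto simp: inversions_def)
  ultimately show ?thesis by (simp add: finite_inversions)
qed

text \<open>This is the ascent case applied to \<open>coxeter_gen i \<circ> \<sigma>\<close>, which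
  has \<open>i\<close> at \<open>q\<close> and \<open>i + 1\<close> at \<open>p\<close>; the
  generator is an involution.\<close>

lemma inversions_coxeter_gen_comp_descent:
  assumes \<sigma>: "\<sigma> permutes {1..n}" and i: "i \<in> {1..<n}"
    and p: "\<sigma> p = i" and q: "\<sigma> q = i + 1" and qp: "q < p"
  shows "card (inversions n \<sigma>) = card (inversions n (coxeter_gen i \<circ> \<sigma>)) + 1"
  using inversions_coxeter_gen_comp[OF coxeter_gen_comp_permutes[OF \<sigma> i] i _ _ qp] p q
  unfolding coxeter_gen_comp_cancel by (simp add: coxeter_gen_def)

lemma card_inversions_coxeter_gen_comp_le:
  assumes \<sigma>: "\<sigma> permutes {1..n}" and i: "i \<in> {1..<n}"
  shows "card (inversions n (coxeter_gen i \<circ> \<sigma>)) \<le> card (inversions n \<sigma>) + 1"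
proof -
  have p: "\<sigma> (inv \<sigma> i) = i" and q: "\<sigma> (inv \<sigma> (i + 1)) = i + 1"
    using \<sigma> by (simp_all add: permutes_inverses)
  then have "inv \<sigma> i \<noteq> inv \<sigma> (i + 1)" by force
  then show ?thesis
    using inversions_coxeter_gen_comp[OF \<sigma> i p q] inversions_coxeter_gen_comp_descent[OF \<sigma> i p q]
    by linarith
qed

section \<open>Coxeter length as the number of inversions\<close>

lemma word_prod_Cons: "word_prod (i # ws) = coxeter_gen i \<circ> word_prod ws"
  by (simp add: word_prod_def)

text \<open>Each letter creates at most one inversion; this is the lower bound for the
  length.\<close>

lemma word_prod_permutes_card_inversions:
  assumes "set ws \<subseteq> {1..<n}"
  shows "word_prod ws permutes {1..n} \<and> card (inversions n (word_prod ws)) \<le> length ws"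
  using assms
proof (induction ws)
  case Nil
  have "word_prod [] = id" by (simp add: word_prod_def)
  then show ?case by (simp only: inversions_id permutes_id) simp
next
  case (Cons i ws)
  then have "word_prod ws permutes {1..n}" "card (inversions n (word_prod ws)) \<le> length ws" "i \<in> {1..<n}"
    by auto
  then show ?case
    using card_inversions_coxeter_gen_comp_le[of "word_prod ws" n i]
      coxeter_gen_comp_permutes[of "word_prod ws" n i]
    unfolding word_prod_Cons list.size by linarith
qed

lemma permutes_no_inverse_descent_imp_id:
  fixes n :: nat
  assumes \<sigma>: "\<sigma> permutes {1..n}" and mono: "\<And>i. i \<in> {1..<n} \<Longrightarrow> inv \<sigma> i < inv \<sigma> (i + 1)"
  shows "\<sigma> = id"
proof -
  have inv: "inv \<sigma> permutes {1..n}" using \<sigma> by (rule permutes_inv)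
  \<comment> \<open>The induction starts at the trivial \<open>0\<close>; positivity of
    \<open>inv \<sigma> 1\<close> gives the step to \<open>1\<close>, monotonicity all later
    ones.\<close>
  have "i \<le> n \<Longrightarrow> i \<le> inv \<sigma> i" for i
  proof (induction i)
    case (Suc i)
    then show ?case
      using mono[of i] permutes_in_image[OF inv, of 1] by (cases "i = 0") auto
  qed simp
  then have "inv \<sigma> = id" using permutes_natset_ge[OF inv] by auto
  then show ?thesis using permutes_inv_inv[OF \<sigma>] by simp
qed

text \<open>Sorting: while some \<open>i + 1\<close> stands to the left of \<open>i\<close>,
  exchanging them removes exactly one inversion, and the letters used spell the word.\<close>

lemma ex_word_card_inversions:
  assumes "\<sigma> permutes {1..n}"
  shows "\<exists>ws. set ws \<subseteq> {1..<n} \<and> length ws = card (inversions n \<sigma>) \<and> word_prod ws = \<sigma>"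
  using assms
proof (induction "card (inversions n \<sigma>)" arbitrary: \<sigma> rule: less_induct)
  case less
  show ?case
  proof (cases "\<forall>i\<in>{1..<n}. inv \<sigma> i < inv \<sigma> (i + 1)")
    case True
    then have "\<sigma> = id" using permutes_no_inverse_descent_imp_id less.prems by blast
    then show ?thesis by (intro exI[of _ "[]"]) (simp add: inversions_id word_prod_def)
  next
    case False
    then obtain i where i: "i \<in> {1..<n}" and le: "inv \<sigma> (i + 1) \<le> inv \<sigma> i" by force
    have p: "\<sigma> (inv \<sigma> i) = i" and q: "\<sigma> (inv \<sigma> (i + 1)) = i + 1"
      using less.prems by (simp_all add: permutes_inverses)
    then have "inv \<sigma> i \<noteq> inv \<sigma> (i + 1)" by force
    then have card: "card (inversions n \<sigma>) = card (inversions n (coxeter_gen i \<circ> \<sigma>)) + 1"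
      using inversions_coxeter_gen_comp_descent[OF less.prems i p q] le by simp
    then obtain ws where "set ws \<subseteq> {1..<n}" "length ws = card (inversions n (coxeter_gen i \<circ> \<sigma>))"
      "word_prod ws = coxeter_gen i \<circ> \<sigma>"
      using less.hyps[OF _ coxeter_gen_comp_permutes[OF less.prems i]] by auto
    then show ?thesis
      using i card by (intro exI[of _ "i # ws"]) (simp add: word_prod_Cons coxeter_gen_comp_cancel)
  qed
qed

lemma coxeter_length_eq_card_inversions:
  assumes "\<sigma> permutes {1..n}"
  shows "coxeter_length n \<sigma> = card (inversions n \<sigma>)"
  unfolding coxeter_length_def
proof (rule Least_equality)
  fix k assume "\<exists>ws. set ws \<subseteq> {1..<n} \<and> length ws = k \<and> word_prod ws = \<sigma>"
  then show "card (inversions n \<sigma>) \<le> k" using word_prod_permutes_card_inversions by blast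
qed (rule ex_word_card_inversions[OF assms])

section \<open>Connecting permutations by type (1) coverings\<close>

lemma type1_coverI:
  assumes \<sigma>: "\<sigma> permutes {1..n}" and i: "i \<in> {1..<n}"
    and p: "\<sigma> p = i" and q: "\<sigma> q = i + 1" and pq: "p < q"
    and between: "\<And>j. p < j \<Longrightarrow> j < q \<Longrightarrow> \<sigma> j < i"
  shows "type1_cover n \<sigma> (coxeter_gen i \<circ> \<sigma>)"
proof -
  have "inv \<sigma> i = p" "inv \<sigma> (i + 1) = q"
    using p q permutes_inv_eq[OF \<sigma>] by auto
  moreover have "weak_cover_at n i \<sigma> (coxeter_gen i \<circ> \<sigma>)"
    using \<sigma> i coxeter_gen_comp_permutes[OF \<sigma> i] inversions_coxeter_gen_comp[OF \<sigma> i p q pq]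
    by (simp add: weak_cover_at_def Sym_def coxeter_length_eq_card_inversions)
  ultimately show ?thesis unfolding type1_cover_def using between by blast
qed

text \<open>The disjunction in the last hypothesis says that each value below \<open>k\<close> has
  the same position in both permutations.\<close>

lemma permutes_agree_below_imp_connected:
  assumes "k \<le> n" "1 \<le> k" "\<sigma> permutes {1..n}" "\<tau> permutes {1..n}"
    and "\<And>j. \<sigma> j < k \<or> \<tau> j < k \<Longrightarrow> \<sigma> j = \<tau> j"
  shows "equivclp (type1_cover n) \<sigma> \<tau>"
  using assms
proof (induction k arbitrary: \<sigma> \<tau> rule: inc_induct)
  case base
  \<comment> \<open>Here \<open>k\<close> is \<open>n\<close>, and the only value in
    \<open>{1..n}\<close> not yet known to agree is \<open>n\<close> itself.\<close>
  have "\<sigma> j = \<tau> j" for j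
  proof (cases "j \<in> {1..n}")
    case True
    then have "\<sigma> j \<le> n" "\<tau> j \<le> n"
      using permutes_in_image[OF base(2), of j] permutes_in_image[OF base(3), of j] by auto
    then show ?thesis using base(4)[of j] by linarith
  next
    case False
    then show ?thesis using base(2,3) by (simp add: permutes_not_in)
  qed
  then have "\<sigma> = \<tau>" by (rule ext)
  then show ?case by simp
next
  case (step k)
  note IH = step.IH and k = step.hyps(2) step.prems(1)
  \<comment> \<open>Inner induction on the distance \<open>q - p\<close>: \<open>\<tau>\<close> and
    \<open>q\<close> stay fixed while \<open>\<sigma>\<close> and \<open>p\<close> vary.\<close>
  have move: "equivclp (type1_cover n) \<sigma> \<tau>"
    if "\<sigma> permutes {1..n}" "\<tau> permutes {1..n}" "\<And>j. \<sigma> j < k \<or> \<tau> j < k \<Longrightarrow> \<sigma> j = \<tau> j"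
      "\<sigma> p = k" "\<tau> q = k" "p \<le> q" for \<sigma> \<tau> p q
    using that
  proof (induction "q - p" arbitrary: \<sigma> p rule: less_induct)
    case less
    note \<sigma> = less.prems(1) and \<tau> = less.prems(2) and agree = less.prems(3)
    have inj: "inj \<sigma>" "inj \<tau>" using \<sigma> \<tau> by (auto dest: permutes_inj)
    show ?case
    proof (cases "p = q")
      case True
      have "\<sigma> j = \<tau> j" if "\<sigma> j < Suc k \<or> \<tau> j < Suc k" for j
        using that agree[of j] less.prems(4,5) True injD[OF inj(1), of j p] injD[OF inj(2), of j q]
        unfolding less_Suc_eq by metis
      then show ?thesis using IH[OF _ \<sigma> \<tau>] by simp
    next
      case False
      define P where "P = (\<lambda>j. p < j \<and> k < \<sigma> j)"
      have "\<sigma> q \<noteq> k" using False less.prems(4) injD[OF inj(1), of p q] by auto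
      \<comment> \<open>A value below \<open>k\<close> at \<open>q\<close> would be shared with
        \<open>\<tau>\<close>, contradicting \<open>\<tau> q = k\<close>. Hence the next larger
        value occurs no later than \<open>q\<close>.\<close>
      then have "P q"
        using False less.prems(5,6) agree[of q] by (fastforce simp: P_def)
      define r where "r = (LEAST j. P j)"
      have "P r" "r \<le> q"
        unfolding r_def using \<open>P q\<close> by (auto intro: LeastI Least_le)
      then have r: "p < r" "k < \<sigma> r" by (auto simp: P_def)
      have between: "\<sigma> j < k" if "p < j" "j < r" for j
      proof -
        have "\<not> P j" using not_less_Least that(2) unfolding r_def by blast
        then have "\<not> k < \<sigma> j" using that(1) by (simp add: P_def)
        moreover have "\<sigma> j \<noteq> k" using that(1) less.prems(4) injD[OF inj(1), of p j] by auto
        ultimately show ?thesis by simp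
      qed
      have k_mem: "k \<in> {1..<n}" using k by simp
      \<comment> \<open>\<open>\<tau> q = k\<close> puts \<open>q\<close> in \<open>{1..n}\<close>,
        hence also \<open>r\<close>, as \<open>0 < r \<le> q\<close>.\<close>
      have "\<sigma> r \<le> n"
        using permutes_in_image[OF \<sigma>, of r] permutes_not_in[OF \<sigma>, of r] r \<open>r \<le> q\<close>
          permutes_in_image[OF \<tau>, of q] less.prems(5) k_mem by auto
      \<comment> \<open>Both exchanged values exceed \<open>k\<close>, so the values up to
        \<open>k\<close> keep their positions and the outer hypothesis at \<open>Suc k\<close>
        connects \<open>\<sigma>\<close> to \<open>\<rho>\<close>.\<close>
      define \<rho> where "\<rho> = transpose (k + 1) (\<sigma> r) \<circ> \<sigma>"
      have \<rho>: "\<rho> permutes {1..n}"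
        unfolding \<rho>_def using k_mem r \<open>\<sigma> r \<le> n\<close> \<sigma>
        by (intro permutes_compose permutes_swap_id) auto
      have \<rho>_low: "\<sigma> j = \<rho> j" if "\<sigma> j < Suc k \<or> \<rho> j < Suc k" for j
        using that r by (auto simp: \<rho>_def transpose_def split: if_splits)
      have \<rho>_p: "\<rho> p = k" using \<rho>_low[of p] less.prems(4) by simp
      have \<rho>_r: "\<rho> r = k + 1" by (simp add: \<rho>_def)
      have "equivclp (type1_cover n) \<sigma> \<rho>"
        by (rule IH[OF _ \<sigma> \<rho> \<rho>_low]) simp_all
      also have "type1_cover n \<rho> (coxeter_gen k \<circ> \<rho>)"
      proof (rule type1_coverI[OF \<rho> k_mem \<rho>_p \<rho>_r r(1)])
        show "\<rho> j < k" if "p < j" "j < r" for j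
          using between[OF that] \<rho>_low[of j] by simp
      qed
      then have "equivclp (type1_cover n) \<rho> (coxeter_gen k \<circ> \<rho>)" by blast
      \<comment> \<open>Now \<open>k\<close> sits at \<open>r\<close>, closer to \<open>q\<close>
        but not past it, and the values below \<open>k\<close> have not moved.\<close>
      also have "equivclp (type1_cover n) (coxeter_gen k \<circ> \<rho>) \<tau>"
      proof (rule less.hyps[of r])
        show "q - r < q - p" using r \<open>r \<le> q\<close> by simp
        show "coxeter_gen k \<circ> \<rho> permutes {1..n}" using \<rho> k_mem by (rule coxeter_gen_comp_permutes)
        show "(coxeter_gen k \<circ> \<rho>) r = k" by (simp add: \<rho>_r coxeter_gen_def)
        show "(coxeter_gen k \<circ> \<rho>) j = \<tau> j" if "(coxeter_gen k \<circ> \<rho>) j < k \<or> \<tau> j < k" for j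
        proof -
          have "\<rho> j < k \<or> \<tau> j < k"
            using that by (auto simp: coxeter_gen_def transpose_def split: if_splits)
          then have "\<rho> j = \<tau> j" "\<rho> j < k" using agree[of j] \<rho>_low[of j] by auto
          then show ?thesis by (simp add: coxeter_gen_def transpose_def)
        qed
      qed (use \<tau> less.prems(5) \<open>r \<le> q\<close> in auto)
      finally show ?thesis .
    qed
  qed
  obtain p q where p: "\<sigma> p = k" and q: "\<tau> q = k"
    using step.prems(2,3) by (metis permutes_inverses(1))
  show ?case
  proof (cases "p \<le> q")
    case True
    then show ?thesis using move[OF step.prems(2-4) p q] by blast
  next
    case False
    then have "equivclp (type1_cover n) \<tau> \<sigma>"
      using move[OF step.prems(3,2) step.prems(4)[symmetric] q p] by auto
    then show ?thesis by (rule equivclp_sym)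
  qed
qed

theorem proposition9p6:
  fixes n :: nat
  assumes "n \<ge> 1"
  shows "connected (with_proj (type1_graph n))"
proof -
  interpret pair_wf_digraph "type1_graph n"
    by unfold_locales (auto simp: type1_graph_def type1_cover_def weak_cover_at_def)
  let ?R = "rtrancl_on (Sym n) ({(\<sigma>, \<omega>). type1_cover n \<sigma> \<omega>}\<^sup>s)"
  have "(\<sigma>, \<tau>) \<in> ?R" if \<sigma>: "\<sigma> \<in> Sym n" and \<tau>: "\<tau> \<in> Sym n" for \<sigma> \<tau>
  proof -
    \<comment> \<open>The only value below \<open>1\<close> is \<open>0\<close>, which both
      permutations fix, so the agreement hypothesis is automatic at \<open>k = 1\<close>.\<close>
    have "\<sigma> j = \<tau> j" if "\<sigma> j < 1 \<or> \<tau> j < 1" for j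
      using that \<sigma> \<tau> permutes_in_image[of \<sigma> "{1..n}" j] permutes_in_image[of \<tau> "{1..n}" j]
      by (cases "j \<in> {1..n}") (auto simp: Sym_def permutes_not_in)
    then have "equivclp (type1_cover n) \<sigma> \<tau>"
      using permutes_agree_below_imp_connected[OF assms, of \<sigma> \<tau>] \<sigma> \<tau> by (auto simp: Sym_def)
    then show ?thesis
    \<comment> \<open>\<open>rtrancl_on\<close> demands that the chain stay in \<open>Sym n\<close>;
      it does, since both ends of every covering lie there.\<close>
    proof (induction rule: equivclp_induct)
      case base
      then show ?case using \<sigma> by simp
    next
      case (step \<rho> \<omega>)
      then have "\<omega> \<in> Sym n" by (auto simp: type1_cover_def weak_cover_at_def)
      moreover have "(\<rho>, \<omega>) \<in> {(\<sigma>, \<omega>). type1_cover n \<sigma> \<omega>}\<^sup>s"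
        using step.hyps(2) by (auto simp: symcl_def)
      ultimately show ?case using step.IH by (blast intro: rtrancl_on_into_rtrancl_on)
    qed
  qed
  \<comment> \<open>Connectedness in the graph library includes that there is a vertex.\<close>
  moreover have "id \<in> Sym n" by (simp add: Sym_def permutes_id)
  moreover have "arcs_ends (with_proj (type1_graph n)) = {(\<sigma>, \<omega>). type1_cover n \<sigma> \<omega>}"
    by (auto simp: type1_graph_def arcs_ends_conv)
  ultimately show ?thesis
    unfolding connected_conv by (auto simp: type1_graph_def)
qed

end
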